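(* Let $d\in(\tfrac12,1)$. Then a random group in the positive square model at density $d$ is, with overwhelming probability, trivial in the following sense: it is isomorphic to $\mathbb{Z}_4=\mathbb{Z}/4\mathbb{Z}$ (all generators being equal). In particular $\Pr\big(\langle a_1,\dots,a_n\mid R_n\rangle\cong \mathbb{Z}/4\mathbb{Z}\big)\to 1$ as $n\to\infty$.
   Context: Positive square model: for $n\ge 1$ let $A_n=\{a_1,\dots,a_n\}$, let $F_n$ be the free group on $A_n$, and let $W_n$ be the set of the $n^4$ positive words of length four over $A_n$ (words using only the letters $a_i$, no inverses). For $d\in(0,1)$ choose a subset $R_n\subset W_n$ with $|R_n|=\lfloor n^{4d}\rfloor$ uniformly at random among all subsets of that size. The quotient $G=\langle A_n\mid R_n\rangle$ of $F_n$ by the normal closure of $R_n$ is a random group in the positive square model at density $d$. A property holds with overwhelming probability if the probability that the random group has it tends to $1$ as $n\to\infty$. In this model every group maps onto $\mathbb{Z}/4\mathbb{Z}$ (send each generator to $1$), so $\mathbb{Z}/4\mathbb{Z}$ is the smallest group that can be obtained; it is called "trivial". *)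

theory Defs
  imports "HOL-Probability.Probability" "HOL-Algebra.Algebra"
begin

section \<open>Free groups\<close>

text \<open>A letter \<open>(a, True)\<close> stands for the generator \<open>a\<close>, a letter \<open>(a, False)\<close> for its formal
  inverse. Elements of the free group are freely reduced words.\<close>

type_synonym 'a word = "('a \<times> bool) list"

definition freely_reduced :: "'a word \<Rightarrow> bool" where
  "freely_reduced = successively (\<lambda>x y. \<not> (fst x = fst y \<and> snd x \<noteq> snd y))"

fun cancel_cons :: "'a \<times> bool \<Rightarrow> 'a word \<Rightarrow> 'a word" where
  "cancel_cons x [] = [x]"
| "cancel_cons x (y # ys) = (if fst x = fst y \<and> snd x \<noteq> snd y then ys else x # y # ys)"

definition free_reduce :: "'a word \<Rightarrow> 'a word" where
  "free_reduce w = foldr cancel_cons w []"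

definition free_group :: "'a set \<Rightarrow> 'a word monoid" where
  "free_group A =
     \<lparr>carrier = {w. w \<in> lists (A \<times> UNIV) \<and> freely_reduced w},
      monoid.mult = (\<lambda>u v. free_reduce (u @ v)),
      one = []\<rparr>"

definition positive_word :: "'a list \<Rightarrow> 'a word" where
  "positive_word w = map (\<lambda>a. (a, True)) w"

lemma reduced_Nil [simp]: "freely_reduced []"
  by (simp add: freely_reduced_def)

lemma reduced_ConsD: "freely_reduced (x # w) \<Longrightarrow> freely_reduced w"
  by (cases w) (auto simp: freely_reduced_def)

lemma reduced_cancel_cons: "freely_reduced w \<Longrightarrow> freely_reduced (cancel_cons x w)"
  by (cases w) (auto simp: freely_reduced_def successively_Cons split: list.splits)

lemma reduced_foldr: "freely_reduced r \<Longrightarrow> freely_reduced (foldr cancel_cons w r)"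
  by (induction w) (auto intro: reduced_cancel_cons)

lemma reduced_reduce: "freely_reduced (free_reduce w)"
  by (simp add: free_reduce_def reduced_foldr)

lemma cancel_cons_in_lists:
  "x \<in> S \<Longrightarrow> w \<in> lists S \<Longrightarrow> cancel_cons x w \<in> lists S"
  by (cases w) auto

lemma reduce_in_lists: "w \<in> lists S \<Longrightarrow> free_reduce w \<in> lists S"
  unfolding free_reduce_def
  by (induction w) (simp_all del: in_lists_conv_set add: cancel_cons_in_lists)

lemma reduce_reduced: "freely_reduced w \<Longrightarrow> free_reduce w = w"
proof (induction w)
  case (Cons x w)
  then have "free_reduce w = w" using reduced_ConsD by blast
  then have "free_reduce (x # w) = cancel_cons x w" by (simp add: free_reduce_def)
  also have "\<dots> = x # w" using Cons.prems by (cases w) (auto simp: freely_reduced_def)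
  finally show ?case .
qed (simp add: free_reduce_def)

lemma cancel_cons_inverse:
  assumes "freely_reduced r" "fst x = fst y" "snd x \<noteq> snd y"
  shows "cancel_cons x (cancel_cons y r) = r"
  using assms
  by (cases r; cases "tl r")
     (auto simp: freely_reduced_def successively_Cons prod_eq_iff split: list.splits)

lemma foldr_cancel_cons:
  assumes "freely_reduced r"
  shows "foldr cancel_cons (cancel_cons x w) r = cancel_cons x (foldr cancel_cons w r)"
  using assms by (cases w) (auto simp: cancel_cons_inverse reduced_foldr)

lemma foldr_reduce:
  assumes "freely_reduced r"
  shows "foldr cancel_cons (free_reduce w) r = foldr cancel_cons w r"
  unfolding free_reduce_def using assms
  by (induction w) (auto simp: foldr_cancel_cons)

lemma reduce_append_left: "free_reduce (free_reduce u @ v) = free_reduce (u @ v)"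
  using foldr_reduce[of "foldr cancel_cons v []" u]
  by (simp add: free_reduce_def reduced_foldr)

lemma reduce_append_right: "free_reduce (u @ free_reduce v) = free_reduce (u @ v)"
  using reduce_reduced[OF reduced_reduce, of v] by (simp add: free_reduce_def)

definition inverse_word :: "'a word \<Rightarrow> 'a word" where
  "inverse_word w = rev (map (\<lambda>(a, e). (a, \<not> e)) w)"

lemma reduce_inverse_word: "free_reduce (inverse_word w @ w) = []"
proof (induction w)
  case (Cons x w)
  have "free_reduce (inverse_word (x # w) @ x # w)
      = foldr cancel_cons (inverse_word w)
          (cancel_cons (fst x, \<not> snd x) (cancel_cons x (free_reduce w)))"
    by (simp add: inverse_word_def free_reduce_def split_def)
  also have "\<dots> = foldr cancel_cons (inverse_word w) (free_reduce w)"
    by (subst cancel_cons_inverse) (auto simp: reduced_reduce)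
  finally show ?case using Cons.IH by (simp add: free_reduce_def)
qed (simp add: inverse_word_def free_reduce_def)

lemma group_free_group: "group (free_group A)"
proof (rule groupI)
  fix u assume u: "u \<in> carrier (free_group A)"
  have "inverse_word u \<in> lists (A \<times> UNIV)"
    using u by (auto simp: free_group_def inverse_word_def)
  then have "free_reduce (inverse_word u) \<in> carrier (free_group A)"
    using reduce_in_lists by (simp add: free_group_def reduced_reduce del: in_lists_conv_set)
  moreover have "free_reduce (inverse_word u) \<otimes>\<^bsub>free_group A\<^esub> u = \<one>\<^bsub>free_group A\<^esub>"
    by (simp add: free_group_def reduce_append_left reduce_inverse_word)
  ultimately show "\<exists>v\<in>carrier (free_group A). v \<otimes>\<^bsub>free_group A\<^esub> u = \<one>\<^bsub>free_group A\<^esub>"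
    by blast
next
  fix u v assume "u \<in> carrier (free_group A)" "v \<in> carrier (free_group A)"
  then show "u \<otimes>\<^bsub>free_group A\<^esub> v \<in> carrier (free_group A)"
    using reduce_in_lists[of "u @ v" "A \<times> UNIV"] by (simp add: free_group_def reduced_reduce)
qed (auto simp: free_group_def reduce_append_left reduce_append_right reduce_reduced)

lemma positive_word_in_free_group:
  "set w \<subseteq> A \<Longrightarrow> positive_word w \<in> carrier (free_group A)"
  by (auto simp: free_group_def positive_word_def freely_reduced_def successively_map
           intro: successively_if_sorted_wrt sorted_wrt_true)


section \<open>Presentations by positive words\<close>

definition normal_closure :: "('a, 'b) monoid_scheme \<Rightarrow> 'a set \<Rightarrow> 'a set" where
  "normal_closure G R = \<Inter> {N. N \<lhd> G \<and> R \<subseteq> N}"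

lemma (in group) normal_normal_closure:
  assumes "R \<subseteq> carrier G"
  shows "normal_closure G R \<lhd> G"
proof -
  have ne: "carrier G \<in> {N. N \<lhd> G \<and> R \<subseteq> N}"
    using assms by (auto simp: normal_inv_iff subgroup_self)
  have "subgroup (normal_closure G R) G"
    unfolding normal_closure_def
    using ne by (intro subgroups_Inter) (auto simp: normal_inv_iff)
  then show ?thesis
    by (auto simp: normal_inv_iff normal_closure_def)
qed

text \<open>The group \<open>\<langle>A | R\<rangle>\<close> for a set \<open>R\<close> of positive words, and the image in it of a generator.\<close>

definition presented_group :: "'a set \<Rightarrow> 'a list set \<Rightarrow> 'a word set monoid" where
  "presented_group A R = free_group A Mod normal_closure (free_group A) (positive_word ` R)"

definition presented_gen :: "'a set \<Rightarrow> 'a list set \<Rightarrow> 'a \<Rightarrow> 'a word set" where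
  "presented_gen A R a =
     normal_closure (free_group A) (positive_word ` R) #>\<^bsub>free_group A\<^esub> positive_word [a]"

lemma group_presented_group:
  assumes "\<And>w. w \<in> R \<Longrightarrow> set w \<subseteq> A"
  shows "group (presented_group A R)"
proof -
  interpret F: group "free_group A" by (rule group_free_group)
  have "normal_closure (free_group A) (positive_word ` R) \<lhd> free_group A"
    using assms by (intro F.normal_normal_closure) (auto intro: positive_word_in_free_group)
  then show ?thesis
    unfolding presented_group_def by (rule normal.factorgroup_is_group)
qed


section \<open>The positive square model\<close>

text \<open>The generator \<open>a\<^sub>i\<close> is represented by the number \<open>i\<close>.\<close>

definition gens :: "nat \<Rightarrow> nat set" where
  "gens n = {1..n}"

definition square_words :: "nat \<Rightarrow> nat list set" where
  "square_words n = {w. length w = 4 \<and> set w \<subseteq> gens n}"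

definition square_relator_sets :: "nat \<Rightarrow> real \<Rightarrow> nat list set set" where
  "square_relator_sets n d =
     {R. R \<subseteq> square_words n \<and> card R = nat \<lfloor>real n powr (4 * d)\<rfloor>}"

definition random_relators :: "nat \<Rightarrow> real \<Rightarrow> nat list set pmf" where
  "random_relators n d = pmf_of_set (square_relator_sets n d)"

definition square_group :: "nat \<Rightarrow> nat list set \<Rightarrow> nat word set monoid" where
  "square_group n R = presented_group (gens n) R"

text \<open>A property of a random group may mention the generators, so it is expressed as a predicate
  on \<open>n\<close> and the relator set.\<close>

definition with_overwhelming_probability :: "real \<Rightarrow> (nat \<Rightarrow> nat list set \<Rightarrow> bool) \<Rightarrow> bool" where
  "with_overwhelming_probability d P \<longleftrightarrow>
     (\<lambda>n. measure_pmf.prob (random_relators n d) {R. P n R}) \<longlonglongrightarrow> 1"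

lemma card_square_words: "card (square_words n) = n ^ 4"
  using card_lists_length_eq[of "gens n" 4]
  by (simp add: square_words_def gens_def conj_commute)

lemma finite_square_words: "finite (square_words n)"
  using finite_lists_length_eq[of "gens n" 4]
  by (simp add: square_words_def gens_def conj_commute)

text \<open>\<open>pmf_of_set\<close> is the uniform distribution only on finite nonempty sets.\<close>

lemma square_relator_sets:
  assumes "d < 1"
  shows "finite (square_relator_sets n d)" "square_relator_sets n d \<noteq> {}"
proof -
  show "finite (square_relator_sets n d)"
    using finite_square_words by (simp add: square_relator_sets_def)
  have "real n powr (4 * d) \<le> real n ^ 4"
  proof (cases "n = 0")
    case False
    then have "real n powr (4 * d) \<le> real n powr 4"
      using assms by (intro powr_mono) auto
    then show ?thesis using False by (simp add: powr_numeral)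
  qed simp
  then have "nat \<lfloor>real n powr (4 * d)\<rfloor> \<le> n ^ 4"
    by (smt (verit) floor_of_nat floor_mono nat_int nat_mono of_nat_power)
  then obtain R where "R \<subseteq> square_words n" "card R = nat \<lfloor>real n powr (4 * d)\<rfloor>"
    using obtain_subset_with_card_n[of _ "square_words n"] by (metis card_square_words)
  then show "square_relator_sets n d \<noteq> {}"
    by (auto simp: square_relator_sets_def)
qed

end

theory Submission
  imports Defs "HOL-Real_Asymp.Real_Asymp"
begin

text \<open>
  Write every word of length four as \<open>uv\<close> with \<open>u\<close>, \<open>v\<close> of length two, and view the relators as
  edges of a bipartite graph between the \<open>N = n\<^sup>2\<close> left halves and the \<open>N\<close> right halves. An edge
  \<open>uv\<close> means that \<open>u\<close> and \<open>v\<inverse>\<close> agree in the group, so if the graph is connected, then all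
  words of length two are equal in the group, hence all generators are equal and their fourth power
  is trivial. Since \<open>d > 1/2\<close>, the mean degree \<open>M/N\<close>, with \<open>M\<close> the number of relators, is a
  positive power of \<open>n\<close>; and a cut with \<open>k \<le> N\<close> vertices on one side has at least \<open>kN/2\<close>
  possible edges, so it is empty with probability at most \<open>exp (- k M / (2 N))\<close>. The union bound
  over all cuts gives \<open>(1 + exp (- M / (2 N)))\<^sup>2\<^sup>N - 1\<close>, which tends to \<open>0\<close>.
\<close>

section \<open>Presentations in which all generators agree\<close>

text \<open>This is the homomorphism from the free group to the integers that sends each generator
  to 1. It is defined on unreduced words too, so that it can be compared before and after
  \<open>free_reduce\<close>.\<close>

definition exponent_sum :: "'a word \<Rightarrow> int" where
  "exponent_sum w = (\<Sum>x\<leftarrow>w. if snd x then 1 else -1)"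

lemma exponent_sum_Nil [simp]: "exponent_sum [] = 0"
  and exponent_sum_Cons [simp]: "exponent_sum (x # w) = (if snd x then 1 else -1) + exponent_sum w"
  and exponent_sum_append: "exponent_sum (u @ v) = exponent_sum u + exponent_sum v"
  by (simp_all add: exponent_sum_def)

lemma exponent_sum_cancel_cons: "exponent_sum (cancel_cons x w) = exponent_sum (x # w)"
  by (cases w) auto

lemma exponent_sum_free_reduce [simp]: "exponent_sum (free_reduce w) = exponent_sum w"
  by (induction w) (simp_all add: free_reduce_def exponent_sum_cancel_cons)

lemma exponent_sum_positive_word [simp]: "exponent_sum (positive_word w) = int (length w)"
  by (induction w) (simp_all add: positive_word_def)

lemma mult_free_group: "u \<otimes>\<^bsub>free_group A\<^esub> v = free_reduce (u @ v)"
  and one_free_group: "\<one>\<^bsub>free_group A\<^esub> = []"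
  by (simp_all add: free_group_def)

text \<open>Prepares induction over reduced words: nothing cancels between the first letter and the
  rest, so the list constructor is a product in the group.\<close>

lemma free_group_ConsD:
  assumes "x # w \<in> carrier (free_group A)"
  shows "[x] \<in> carrier (free_group A)" "w \<in> carrier (free_group A)"
    "x # w = [x] \<otimes>\<^bsub>free_group A\<^esub> w"
  using assms reduced_ConsD[of x w] reduce_reduced[of "x # w"]
  by (auto simp: free_group_def freely_reduced_def)

lemma positive_word_append:
  "positive_word (u @ v) = positive_word u \<otimes>\<^bsub>free_group A\<^esub> positive_word v"
proof -
  have "freely_reduced (positive_word (u @ v))"
    using positive_word_in_free_group[of "u @ v" UNIV] by (simp add: free_group_def)
  then show ?thesis
    by (simp add: mult_free_group reduce_reduced positive_word_def)
qed

lemma inv_free_group_letter: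
  assumes "b \<in> A"
  shows "inv\<^bsub>free_group A\<^esub> positive_word [b] = [(b, False)]"
proof (rule group.inv_equality[OF group_free_group])
  show "positive_word [b] \<in> carrier (free_group A)"
    using assms by (intro positive_word_in_free_group) auto
qed (use assms in \<open>auto simp: free_group_def positive_word_def free_reduce_def freely_reduced_def\<close>)

lemma exponent_sum_hom:
  assumes "m > 0"
  shows "(\<lambda>w. exponent_sum w mod int m) \<in> hom (free_group A) (integer_mod_group m)"
  using assms
  by (auto simp: hom_def carrier_integer_mod_group mult_free_group exponent_sum_append mod_add_eq)

section \<open>The projection from the free group onto a presented group\<close>

lemma presented_gen_group_hom:
  assumes "\<And>w. w \<in> R \<Longrightarrow> set w \<subseteq> A"
  shows "group_hom (free_group A) (presented_group A R)
           (\<lambda>w. normal_closure (free_group A) (positive_word ` R) #>\<^bsub>free_group A\<^esub> w)"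
proof -
  interpret F: group "free_group A" by (rule group_free_group)
  have "normal_closure (free_group A) (positive_word ` R) \<lhd> free_group A"
    using assms by (intro F.normal_normal_closure) (auto intro: positive_word_in_free_group)
  then show ?thesis
    using normal.r_coset_hom_Mod group_presented_group[of R A] assms
    by (auto simp: group_hom_def group_hom_axioms_def presented_group_def F.is_group)
qed

lemma presented_gen_relator:
  assumes "\<And>w. w \<in> R \<Longrightarrow> set w \<subseteq> A" and "w \<in> R"
  shows "normal_closure (free_group A) (positive_word ` R) #>\<^bsub>free_group A\<^esub> positive_word w
           = \<one>\<^bsub>presented_group A R\<^esub>"
proof -
  interpret F: group "free_group A" by (rule group_free_group)
  have "normal_closure (free_group A) (positive_word ` R) \<lhd> free_group A"
    using assms by (intro F.normal_normal_closure) (auto intro: positive_word_in_free_group)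
  moreover have "positive_word w \<in> normal_closure (free_group A) (positive_word ` R)"
    using assms(2) by (auto simp: normal_closure_def)
  moreover have "positive_word w \<in> carrier (free_group A)"
    using assms by (intro positive_word_in_free_group) auto
  ultimately show ?thesis
    by (simp add: presented_group_def FactGroup_def F.coset_join2 normal_imp_subgroup)
qed

text \<open>When all generators have the same image \<open>g\<close>, a word maps to
  \<open>g\<close> raised to its exponent sum. The normal closure is therefore the kernel of the
  exponent sum mod \<open>m\<close>, and the first isomorphism theorem applies.\<close>

lemma presented_group_iso_integer_mod_group:
  assumes a: "a \<in> A" and m: "m > 0"
    and R: "\<And>w. w \<in> R \<Longrightarrow> set w \<subseteq> A" "\<And>w. w \<in> R \<Longrightarrow> m dvd length w"
    and eq: "\<And>b. b \<in> A \<Longrightarrow> presented_gen A R b = presented_gen A R a"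
    and pow: "presented_gen A R a [^]\<^bsub>presented_group A R\<^esub> m = \<one>\<^bsub>presented_group A R\<^esub>"
  shows "presented_group A R \<cong> integer_mod_group m"
proof -
  let ?F = "free_group A" and ?Z = "integer_mod_group m" and ?Q = "presented_group A R"
  let ?\<phi> = "\<lambda>w. exponent_sum w mod int m"
  let ?N = "normal_closure ?F (positive_word ` R)"
  let ?\<pi> = "\<lambda>w. ?N #>\<^bsub>?F\<^esub> w"
  let ?g = "presented_gen A R a"
  interpret F: group ?F by (rule group_free_group)
  interpret \<phi>: group_hom ?F ?Z ?\<phi>
    using exponent_sum_hom[OF m] group_free_group
    by (auto simp: group_hom_def group_hom_axioms_def)
  interpret \<pi>: group_hom ?F ?Q ?\<pi>
    using R(1) by (rule presented_gen_group_hom)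
  have N: "?N \<lhd> ?F"
    using R(1) by (intro F.normal_normal_closure) (auto intro: positive_word_in_free_group)
  have pos: "positive_word [b] \<in> carrier ?F" if "b \<in> A" for b
    using that by (intro positive_word_in_free_group) auto
  have g: "?g \<in> carrier ?Q"
    unfolding presented_gen_def using pos[OF a] by (rule \<pi>.hom_closed)
  have \<pi>: "?\<pi> w = ?g [^]\<^bsub>?Q\<^esub> exponent_sum w" if "w \<in> carrier ?F" for w
    using that
  proof (induction w)
    case Nil
    then show ?case using \<pi>.hom_one by (simp add: one_free_group)
  next
    case (Cons x w)
    note x = free_group_ConsD[OF Cons.prems]
    obtain b e where be: "x = (b, e)" by (cases x)
    with x(1) have b: "b \<in> A" by (auto simp: free_group_def)
    have letter: "?\<pi> [x] = ?g [^]\<^bsub>?Q\<^esub> (if e then 1 else - 1 :: int)"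
    proof (cases e)
      case True
      then show ?thesis
        using eq[OF b] g be by (simp add: presented_gen_def positive_word_def \<pi>.int_pow_1)
    next
      case False
      then have "?\<pi> [x] = inv\<^bsub>?Q\<^esub> ?\<pi> (positive_word [b])"
        using \<pi>.hom_inv[OF pos[OF b]] be by (simp add: inv_free_group_letter[OF b])
      also have "\<dots> = inv\<^bsub>?Q\<^esub> ?g"
        using eq[OF b] by (simp add: presented_gen_def)
      finally show ?thesis
        using False g by (simp add: \<pi>.int_pow_neg)
    qed
    have "?\<pi> (x # w) = ?\<pi> [x] \<otimes>\<^bsub>?Q\<^esub> ?\<pi> w"
      unfolding x(3) by (rule \<pi>.hom_mult[OF x(1,2)])
    also have "\<dots> = ?g [^]\<^bsub>?Q\<^esub> ((if e then 1 else - 1) + exponent_sum w)"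
      unfolding letter Cons.IH[OF x(2)] by (rule \<pi>.int_pow_mult[OF g, symmetric])
    finally show ?case by (simp add: be)
  qed
  have "?N = kernel ?F ?Z ?\<phi>"
  proof
    \<comment> \<open>The kernel is normal and contains the relators because their lengths are
      multiples of \<open>m\<close>; minimality of the normal closure does the rest.\<close>
    have "positive_word ` R \<subseteq> kernel ?F ?Z ?\<phi>"
      using R by (auto simp: kernel_def positive_word_in_free_group mod_eq_0_iff_dvd)
    then show "?N \<subseteq> kernel ?F ?Z ?\<phi>"
      using \<phi>.normal_kernel by (auto simp: normal_closure_def)
  next
    show "kernel ?F ?Z ?\<phi> \<subseteq> ?N"
    proof
      fix w assume "w \<in> kernel ?F ?Z ?\<phi>"
      then have w: "w \<in> carrier ?F" and "int m dvd exponent_sum w"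
        by (auto simp: kernel_def)
      then obtain k where k: "exponent_sum w = int m * k" by (elim dvdE)
      \<comment> \<open>The reverse inclusion is where \<open>g\<close> to the power
        \<open>m\<close> being trivial enters.\<close>
      have "?\<pi> w = (?g [^]\<^bsub>?Q\<^esub> int m) [^]\<^bsub>?Q\<^esub> k"
        using \<pi>[OF w] g by (simp add: k \<pi>.int_pow_pow)
      also have "\<dots> = \<one>\<^bsub>?Q\<^esub>"
        using pow by (simp add: int_pow_int)
      finally have "?\<pi> w = ?N"
        by (simp add: presented_group_def FactGroup_def)
      then show "w \<in> ?N"
        using w N by (meson F.coset_join1 normal_imp_subgroup)
    qed
  qed
  moreover have "?\<phi> ` carrier ?F = carrier ?Z"
  proof (intro equalityI subsetI)
    fix z assume z: "z \<in> carrier ?Z"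
    then have "z = ?\<phi> (positive_word (replicate (nat z) a))"
      using m by (simp add: carrier_integer_mod_group)
    moreover have "positive_word (replicate (nat z) a) \<in> carrier ?F"
      using a by (intro positive_word_in_free_group) auto
    ultimately show "z \<in> ?\<phi> ` carrier ?F" by blast
  qed (use \<phi>.hom_closed in auto)
  ultimately show ?thesis
    using \<phi>.FactGroup_iso by (simp add: presented_group_def)
qed

section \<open>The bipartite graph of relators\<close>

definition half_words :: "nat \<Rightarrow> nat list set" where
  "half_words n = {u. length u = 2 \<and> set u \<subseteq> gens n}"

text \<open>The pair \<open>(S, T)\<close> is a vertex set of the bipartite graph, with
  \<open>S\<close> on the left and \<open>T\<close> on the right. The cut consists of all possible
  edges with exactly one end in it.\<close>

definition cut :: "nat \<Rightarrow> nat list set \<Rightarrow> nat list set \<Rightarrow> nat list set" where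
  "cut n S T = {w \<in> square_words n. (take 2 w \<in> S) \<noteq> (drop 2 w \<in> T)}"

lemma finite_half_words: "finite (half_words n)"
  and card_half_words: "card (half_words n) = n\<^sup>2"
  using finite_lists_length_eq[of "gens n" 2] card_lists_length_eq[of "gens n" 2]
  by (simp_all add: half_words_def gens_def conj_commute)

lemma square_words_halves:
  assumes "w \<in> square_words n"
  shows "take 2 w \<in> half_words n" "drop 2 w \<in> half_words n"
  using assms set_take_subset[of 2 w] set_drop_subset[of 2 w]
  by (auto simp: square_words_def half_words_def)

lemma append_half_words:
  assumes "u \<in> half_words n" "v \<in> half_words n"
  shows "u @ v \<in> square_words n"
  using assms by (auto simp: square_words_def half_words_def)

text \<open>Allows the union bound to run only over vertex sets with at most half of the
  \<open>2 * n^2\<close> vertices.\<close>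

lemma cut_complement:
  "cut n (half_words n - S) (half_words n - T) = cut n S T"
  unfolding cut_def using square_words_halves by blast

lemma cut_eq:
  assumes "S \<subseteq> half_words n" "T \<subseteq> half_words n"
  shows "cut n S T = (\<lambda>(u, v). u @ v) ` (S \<times> (half_words n - T) \<union> (half_words n - S) \<times> T)"
    (is "_ = _ ` ?P")
proof (intro equalityI subsetI)
  fix w assume "w \<in> cut n S T"
  then have "(take 2 w, drop 2 w) \<in> ?P"
    using square_words_halves by (auto simp: cut_def)
  then show "w \<in> (\<lambda>(u, v). u @ v) ` ?P"
    by (force intro: image_eqI[of _ _ "(take 2 w, drop 2 w)"])
next
  fix w assume "w \<in> (\<lambda>(u, v). u @ v) ` ?P"
  then obtain u v where uv: "(u, v) \<in> ?P" "w = u @ v" by auto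
  then have "u \<in> half_words n" "v \<in> half_words n" using assms by auto
  with uv show "w \<in> cut n S T"
    using append_half_words by (auto simp: cut_def half_words_def)
qed

lemma card_cut:
  assumes S: "S \<subseteq> half_words n" and T: "T \<subseteq> half_words n"
  shows "real (card (cut n S T)) =
           real (card S) * (real n ^ 2 - real (card T)) + (real n ^ 2 - real (card S)) * real (card T)"
proof -
  let ?V = "half_words n"
  have fin: "finite S" "finite T" using S T finite_half_words by (auto intro: finite_subset)
  have diff: "real (card (?V - B)) = real n ^ 2 - real (card B)" if "B \<subseteq> ?V" for B
    using that card_mono[OF finite_half_words that] finite_subset[OF that finite_half_words]
    by (simp add: card_Diff_subset card_half_words of_nat_diff)
  \<comment> \<open>All left halves have length two, so a concatenation determines its two
    factors.\<close>
  have "inj_on (\<lambda>(u, v). u @ v) (S \<times> (?V - T) \<union> (?V - S) \<times> T)"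
  proof (rule inj_onI)
    fix p q assume *: "p \<in> S \<times> (?V - T) \<union> (?V - S) \<times> T" "q \<in> S \<times> (?V - T) \<union> (?V - S) \<times> T"
      "(\<lambda>(u, v). u @ v) p = (\<lambda>(u, v). u @ v) q"
    then have "length (fst p) = 2" "length (fst q) = 2"
      using S by (auto simp: half_words_def)
    with *(3) show "p = q" by (cases p; cases q) auto
  qed
  then have "card (cut n S T) = card (S \<times> (?V - T) \<union> (?V - S) \<times> T)"
    unfolding cut_eq[OF S T] by (rule card_image)
  also have "\<dots> = card S * card (?V - T) + card (?V - S) * card T"
    using fin finite_half_words
    by (subst card_Un_disjoint) (auto simp: card_cartesian_product)
  finally show ?thesis
    using S T by (simp add: diff)
qed

text \<open>With \<open>s\<close>, \<open>t\<close> the two sizes and \<open>N = n^2\<close>, the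
  cut has \<open>(s + t) * N - 2 * s * t\<close> edges. By AM-GM and \<open>s + t\<close> \<le>
  \<open>N\<close>, the subtracted term is at most \<open>(s + t)^2 / 2\<close>, hence at most
  \<open>(s + t) * N / 2\<close>.\<close>

lemma card_cut_ge:
  assumes "S \<subseteq> half_words n" "T \<subseteq> half_words n" "card S + card T \<le> n\<^sup>2"
  shows "real (card S + card T) * real n ^ 2 / 2 \<le> real (card (cut n S T))"
proof -
  define s t N where "s = real (card S)" and "t = real (card T)" and "N = real n ^ 2"
  have "s + t \<le> N"
    using assms(3) unfolding s_def t_def N_def by (metis of_nat_add of_nat_le_iff of_nat_power)
  then have "(s + t) * (s + t) \<le> (s + t) * N"
    by (intro mult_left_mono) (auto simp: s_def t_def)
  moreover have "4 * (s * t) \<le> (s + t) * (s + t)"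
    using sum_squares_bound[of s t] by (simp add: algebra_simps power2_eq_square)
  moreover have "s * (N - t) + (N - s) * t = (s + t) * N - 2 * (s * t)"
    by (simp add: algebra_simps)
  ultimately have "(s + t) * N / 2 \<le> s * (N - t) + (N - s) * t"
    by linarith
  then show ?thesis
    using card_cut[OF assms(1,2)] by (simp add: s_def t_def N_def)
qed

text \<open>Connectedness is stated through cuts instead of paths, which suits the union bound. It
  is applied to the vertices labelled by one fixed group element, where a left half is labelled by
  its image and a right half by the inverse of its image: relators join only vertices with equal
  labels.\<close>

lemma square_group_trivial_if_cuts_met:
  assumes n: "n > 0" and R: "R \<subseteq> square_words n"
    and met: "\<And>S T. S \<subseteq> half_words n \<Longrightarrow> T \<subseteq> half_words n \<Longrightarrow> S \<noteq> {} \<Longrightarrow>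
                 R \<inter> cut n S T = {} \<Longrightarrow> S = half_words n \<and> T = half_words n"
  shows "square_group n R \<cong> integer_mod_group 4 \<and>
           (\<forall>i\<in>gens n. \<forall>j\<in>gens n. presented_gen (gens n) R i = presented_gen (gens n) R j)"
proof -
  let ?A = "gens n" and ?V = "half_words n"
  let ?F = "free_group ?A" and ?Q = "presented_group ?A R"
  let ?q = "presented_gen ?A R"
  define \<pi> where "\<pi> w = normal_closure ?F (positive_word ` R) #>\<^bsub>?F\<^esub> positive_word w" for w
  have RA: "set w \<subseteq> ?A" if "w \<in> R" for w
    using R that by (auto simp: square_words_def)
  interpret \<pi>: group_hom ?F ?Q "\<lambda>w. normal_closure ?F (positive_word ` R) #>\<^bsub>?F\<^esub> w"
    using RA by (rule presented_gen_group_hom)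
  have closed: "\<pi> u \<in> carrier ?Q" if "set u \<subseteq> ?A" for u
    unfolding \<pi>_def using positive_word_in_free_group[OF that] by (rule \<pi>.hom_closed)
  have app: "\<pi> (u @ v) = \<pi> u \<otimes>\<^bsub>?Q\<^esub> \<pi> v" if "set u \<subseteq> ?A" "set v \<subseteq> ?A" for u v
    unfolding \<pi>_def positive_word_append[of u v ?A]
    using that by (intro \<pi>.hom_mult positive_word_in_free_group)
  have rel: "\<pi> w = \<one>\<^bsub>?Q\<^esub>" if "w \<in> R" for w
    unfolding \<pi>_def using RA that by (rule presented_gen_relator)
  have q: "?q i = \<pi> [i]" for i by (simp add: presented_gen_def \<pi>_def)
  have qc: "?q i \<in> carrier ?Q" if "i \<in> ?A" for i
    using closed[of "[i]"] that by (simp add: q)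
  have V: "set u \<subseteq> ?A" if "u \<in> ?V" for u using that by (simp add: half_words_def)
  have two: "[i, j] \<in> ?V" "\<pi> [i, j] = ?q i \<otimes>\<^bsub>?Q\<^esub> ?q j" if "i \<in> ?A" "j \<in> ?A" for i j
    using that app[of "[i]" "[j]"] by (auto simp: half_words_def q)
  have one: "1 \<in> ?A" using n by (simp add: gens_def)
  define c where "c = \<pi> [1, 1]"
  define S where "S = {u \<in> ?V. \<pi> u = c}"
  define T where "T = {v \<in> ?V. inv\<^bsub>?Q\<^esub> \<pi> v = c}"
  have edge: "\<pi> (take 2 w) = inv\<^bsub>?Q\<^esub> \<pi> (drop 2 w)" if "w \<in> R" for w
  proof -
    have h: "set (take 2 w) \<subseteq> ?A" "set (drop 2 w) \<subseteq> ?A"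
      using square_words_halves[of w n] V R that by auto
    then have "\<pi> (take 2 w) \<otimes>\<^bsub>?Q\<^esub> \<pi> (drop 2 w) = \<one>\<^bsub>?Q\<^esub>"
      using app[OF h] rel[OF that] by simp
    then show ?thesis
      using closed[OF h(1)] closed[OF h(2)] \<pi>.inv_equality by metis
  qed
  have "R \<inter> cut n S T = {}"
  proof -
    have "take 2 w \<in> S \<longleftrightarrow> drop 2 w \<in> T" if "w \<in> R" for w
      using edge[OF that] square_words_halves[of w n] R that by (auto simp: S_def T_def)
    then show ?thesis by (auto simp: cut_def)
  qed
  moreover have "[1, 1] \<in> S"
    using two one by (simp add: S_def c_def)
  ultimately have ST: "S = ?V" "T = ?V"
    using met[of S T] by (auto simp: S_def T_def)
  \<comment> \<open>On the left side, \<open>[1, i]\<close> and \<open>[1, 1]\<close> have the same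
    image; cancelling the first letter identifies the generators.\<close>
  have eq: "?q i = ?q 1" if "i \<in> ?A" for i
  proof -
    have "[1, i] \<in> S" using two(1)[OF one that] ST by simp
    then have "?q 1 \<otimes>\<^bsub>?Q\<^esub> ?q i = ?q 1 \<otimes>\<^bsub>?Q\<^esub> ?q 1"
      using two(2) one that by (simp add: S_def c_def)
    then show ?thesis using qc one that by simp
  qed
  have cc: "c \<in> carrier ?Q" "c = ?q 1 \<otimes>\<^bsub>?Q\<^esub> ?q 1"
    using two(2)[OF one one] qc[OF one] by (simp_all add: c_def)
  \<comment> \<open>On the right side, \<open>[1, 1]\<close> shows that \<open>c\<close> is its own
    inverse; as \<open>c\<close> is the square of a generator, that generator has trivial fourth
    power.\<close>
  have "[1, 1] \<in> T" using two(1)[OF one one] ST by simp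
  then have "inv\<^bsub>?Q\<^esub> c = c" by (simp add: T_def c_def)
  then have "c \<otimes>\<^bsub>?Q\<^esub> c = \<one>\<^bsub>?Q\<^esub>" using \<pi>.r_inv[OF cc(1)] by simp
  then have "?q 1 [^]\<^bsub>?Q\<^esub> (4::nat) = \<one>\<^bsub>?Q\<^esub>"
    using cc qc[OF one] by (simp add: numeral_eq_Suc \<pi>.m_assoc)
  moreover have "4 dvd length w" if "w \<in> R" for w
    using R that by (auto simp: square_words_def)
  ultimately have "?Q \<cong> integer_mod_group 4"
    using RA eq by (intro presented_group_iso_integer_mod_group[OF one zero_less_numeral]) blast+
  then show ?thesis
    unfolding square_group_def using eq by metis
qed

section \<open>The union bound\<close>

text \<open>Cleared of denominators: \<open>M\<close> draws without replacement avoid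
  \<open>c\<close> of \<open>K\<close> elements at most as likely as \<open>M\<close> draws with
  replacement. The induction compares the factors \<open>(K - c - M) / (K - M)\<close> and
  \<open>(K - c) / K\<close>.\<close>

lemma binomial_diff_mult_power_le:
  fixes K c M :: nat
  assumes "c \<le> K"
  shows "((K - c) choose M) * K ^ M \<le> (K choose M) * (K - c) ^ M"
proof (induction M)
  case (Suc M)
  have ratio: "(K - c - M) * K \<le> (K - M) * (K - c)"
  \<comment> \<open>In the first case the two sides differ by \<open>c * M\<close>; in the other the
    truncated subtraction makes the left side 0.\<close>
  proof (cases "M \<le> K - c")
    case True
    then obtain r where r: "K = r + c + M"
      using assms by (metis add.commute add.assoc le_add_diff_inverse2 le_add_diff_inverse)
    show ?thesis by (simp add: r algebra_simps)
  qed simp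
  have rec: "Suc M * (k choose Suc M) = (k - M) * (k choose M)" for k
    by (metis binomial_absorb_comp binomial_absorption diff_Suc_1 mult.commute)
  have "Suc M * (((K - c) choose Suc M) * K ^ Suc M)
      = (Suc M * ((K - c) choose Suc M)) * (K * K ^ M)"
    by (simp only: power_Suc mult.assoc)
  also have "\<dots> = ((K - c - M) * K) * (((K - c) choose M) * K ^ M)"
    unfolding rec by (simp only: mult_ac)
  also have "\<dots> \<le> ((K - M) * (K - c)) * ((K choose M) * (K - c) ^ M)"
    using ratio Suc.IH by (rule mult_le_mono)
  also have "\<dots> = (Suc M * (K choose Suc M)) * ((K - c) * (K - c) ^ M)"
    unfolding rec by (simp only: mult_ac)
  also have "\<dots> = Suc M * ((K choose Suc M) * (K - c) ^ Suc M)"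
    by (simp only: power_Suc mult.assoc)
  finally show ?case
    by (simp only: Suc_mult_le_cancel1)
qed simp

lemma prob_random_subset_avoids:
  assumes W: "finite W" and C: "C \<subseteq> W" and M: "M \<le> card W"
  shows "measure_pmf.prob (pmf_of_set {R. R \<subseteq> W \<and> card R = M}) {R. R \<inter> C = {}}
           \<le> exp (- real (card C) * real M / real (card W))"
\<comment> \<open>Division by zero gives 0 here, so the bound is \<open>exp 0 = 1\<close>.\<close>
proof (cases "card W = 0")
  case True
  then show ?thesis by simp
next
  case False
  let ?X = "{R. R \<subseteq> W \<and> card R = M}"
  define K c where "K = card W" and "c = card C"
  have K: "K > 0" and c: "c \<le> K" using False C W by (auto simp: K_def c_def card_mono)
  have finX: "finite ?X" using W by simp
  have cardX: "card ?X = K choose M" using n_subsets[OF W] by (simp add: K_def)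
  have pos: "0 < K choose M" using M by (simp add: K_def)
  then have "?X \<noteq> {}" using cardX by (metis card.empty less_numeral_extra(3))
  moreover have "?X \<inter> {R. R \<inter> C = {}} = {R. R \<subseteq> W - C \<and> card R = M}" by auto
  moreover have "card {R. R \<subseteq> W - C \<and> card R = M} = (K - c) choose M"
    using n_subsets[of "W - C"] W card_Diff_subset[OF finite_subset[OF C W] C]
    by (simp add: K_def c_def)
  ultimately have "measure_pmf.prob (pmf_of_set ?X) {R. R \<inter> C = {}}
      = real ((K - c) choose M) / real (K choose M)"
    using finX by (simp add: measure_pmf_of_set cardX)
  also have "\<dots> \<le> (real (K - c) / real K) ^ M"
  proof -
    have "real ((K - c) choose M) * real K ^ M \<le> real (K choose M) * real (K - c) ^ M"
      using binomial_diff_mult_power_le[OF c, of M]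
      by (metis of_nat_le_iff of_nat_mult of_nat_power)
    then show ?thesis
      using pos K by (simp add: power_divide divide_simps mult_ac)
  qed
  also have "\<dots> \<le> exp (- real c / real K) ^ M"
  proof (rule power_mono)
    have "real (K - c) / real K = 1 + (- real c / real K)"
      using c K by (simp add: of_nat_diff diff_divide_distrib)
    then show "real (K - c) / real K \<le> exp (- real c / real K)"
      using exp_ge_add_one_self[of "- real c / real K"] by simp
  qed simp
  also have "\<dots> = exp (- real c * real M / real K)"
    by (simp add: exp_of_nat_mult[symmetric] mult_ac)
  finally show ?thesis by (simp add: K_def c_def)
qed

text \<open>Expanding the product of \<open>1 + x\<close> over \<open>A\<close> yields one term per
  subset. This evaluates the union bound in closed form.\<close>

lemma sum_Pow_power_card:
  fixes x :: real
  assumes "finite A"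
  shows "(\<Sum>B\<in>Pow A. x ^ card B) = (1 + x) ^ card A"
  using prod_add[OF assms, of "\<lambda>_. x" "\<lambda>_. 1"] by (simp add: add.commute)

text \<open>Each vertex of a cut contributes a factor \<open>x\<close>, so the failure probability
  is at most \<open>(1 + x) ^ (2 * n^2) - 1\<close>, and \<open>1 + x\<close> \<le>
  \<open>exp x\<close>.\<close>

lemma prob_square_group_trivial_ge:
  fixes n :: nat and d :: real
  assumes n: "n > 0" and d: "d < 1"
  defines "x \<equiv> exp (- real (nat \<lfloor>real n powr (4 * d)\<rfloor>) / (2 * real n ^ 2))"
  shows "measure_pmf.prob (random_relators n d)
           {R. square_group n R \<cong> integer_mod_group 4 \<and>
               (\<forall>i\<in>gens n. \<forall>j\<in>gens n. presented_gen (gens n) R i = presented_gen (gens n) R j)}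
         \<ge> 2 - exp (2 * real n ^ 2 * x)"
    (is "measure_pmf.prob ?p ?good \<ge> _")
proof -
  let ?V = "half_words n"
  define M where "M = nat \<lfloor>real n powr (4 * d)\<rfloor>"
  \<comment> \<open>The empty vertex set must be left out: its cut is empty and always
    avoided.\<close>
  define I where "I = {(S, T) \<in> Pow ?V \<times> Pow ?V. 0 < card S + card T \<and> card S + card T \<le> n\<^sup>2}"
  let ?avoid = "\<lambda>(S, T). {R. R \<inter> cut n S T = {}}"
  have finV2: "finite (Pow ?V \<times> Pow ?V)" using finite_half_words by simp
  have finI: "finite I" unfolding I_def by (rule finite_subset[OF _ finV2]) auto
  have set: "set_pmf ?p = square_relator_sets n d"
    using square_relator_sets[OF d] by (simp add: random_relators_def)
  obtain R where "R \<subseteq> square_words n" "card R = M"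
    using square_relator_sets(2)[OF d, of n] by (auto simp: square_relator_sets_def M_def)
  then have M: "M \<le> card (square_words n)"
    using card_mono[OF finite_square_words] by blast
  have bad: "set_pmf ?p \<inter> - ?good \<subseteq> (\<Union>P\<in>I. ?avoid P)"
  proof
    fix R assume *: "R \<in> set_pmf ?p \<inter> - ?good"
    then have R: "R \<subseteq> square_words n"
      by (auto simp: set square_relator_sets_def)
    obtain S T where ST: "S \<subseteq> ?V" "T \<subseteq> ?V" "S \<noteq> {}" "R \<inter> cut n S T = {}"
      "S \<noteq> ?V \<or> T \<noteq> ?V"
      using square_group_trivial_if_cuts_met[OF n R] * by blast
    have fin: "finite S" "finite T"
      using ST(1,2) finite_half_words by (auto intro: finite_subset)
    show "R \<in> (\<Union>P\<in>I. ?avoid P)"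
    proof (cases "card S + card T \<le> n\<^sup>2")
      case True
      then have "(S, T) \<in> I" using ST fin by (auto simp: I_def card_gt_0_iff)
      then show ?thesis using ST by blast
    next
      case False
      \<comment> \<open>A vertex set with more than \<open>n^2\<close> vertices is replaced by its
        complement, which has fewer than \<open>n^2\<close> and is nonempty because
        \<open>(S, T)\<close> is not everything.\<close>
      have "card (?V - S) = n\<^sup>2 - card S" "card (?V - T) = n\<^sup>2 - card T"
        "card S \<le> n\<^sup>2" "card T \<le> n\<^sup>2"
        using ST fin card_mono[OF finite_half_words]
        by (simp_all add: card_Diff_subset card_half_words[symmetric])
      moreover have "card S < n\<^sup>2 \<or> card T < n\<^sup>2"
        using ST psubset_card_mono[OF finite_half_words] by (metis card_half_words psubsetI)
      ultimately have "(?V - S, ?V - T) \<in> I"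
        using False by (auto simp: I_def)
      moreover have "R \<inter> cut n (?V - S) (?V - T) = {}"
        using ST by (simp add: cut_complement)
      ultimately show ?thesis by blast
    qed
  qed
  have avoid: "measure_pmf.prob ?p (?avoid P) \<le> x ^ card (fst P) * x ^ card (snd P)"
    if P: "P \<in> I" for P
  proof -
    obtain S T where ST: "P = (S, T)" by (cases P)
    with P have sub: "S \<subseteq> ?V" "T \<subseteq> ?V" and le: "card S + card T \<le> n\<^sup>2"
      by (auto simp: I_def)
    have "measure_pmf.prob ?p (?avoid P)
        \<le> exp (- real (card (cut n S T)) * real M / real (card (square_words n)))"
      using prob_random_subset_avoids[OF finite_square_words _ M, of "cut n S T"]
      by (auto simp: ST cut_def random_relators_def square_relator_sets_def M_def)
    also have "\<dots> \<le> exp (- (real (card S + card T) * real n ^ 2 / 2) * real M / real n ^ 4)"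
    proof -
      have "(real (card S + card T) * real n ^ 2 / 2) * real M / real n ^ 4
          \<le> real (card (cut n S T)) * real M / real n ^ 4"
        using card_cut_ge[OF sub le] by (intro divide_right_mono mult_right_mono) auto
      then show ?thesis by (simp add: card_square_words)
    qed
    also have "- (real (card S + card T) * real n ^ 2 / 2) * real M / real n ^ 4
        = real (card S + card T) * (- real M / (2 * real n ^ 2))"
      using n by (simp add: field_simps power2_eq_square power4_eq_xxxx)
    also have "exp \<dots> = x ^ (card S + card T)"
      unfolding x_def M_def[symmetric] by (rule exp_of_nat_mult)
    finally show ?thesis by (simp add: ST power_add)
  qed
  have x0: "x \<ge> 0" by (simp add: x_def)
  have "1 - measure_pmf.prob ?p ?good = measure_pmf.prob ?p (- ?good)"
    using measure_pmf.prob_compl[of ?good ?p] by (simp add: Compl_eq_Diff_UNIV)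
  also have "\<dots> \<le> measure_pmf.prob ?p (\<Union>P\<in>I. ?avoid P)"
    using bad measure_pmf.finite_measure_mono[of "set_pmf ?p \<inter> - ?good" "\<Union>P\<in>I. ?avoid P" ?p]
      measure_Int_set_pmf[of ?p "- ?good"]
    by (simp only: Int_commute[of "- ?good"]) simp
  also have "\<dots> \<le> (\<Sum>P\<in>I. measure_pmf.prob ?p (?avoid P))"
    using finI by (intro measure_pmf.finite_measure_subadditive_finite) auto
  also have "\<dots> \<le> (\<Sum>P\<in>I. x ^ card (fst P) * x ^ card (snd P))"
    using avoid by (rule sum_mono)
  \<comment> \<open>Dropping the size cap lets the sum factor over \<open>S\<close> and
    \<open>T\<close>; the excluded empty pair accounts for the \<open>- 1\<close> that
    follows.\<close>
  also have "\<dots> \<le> (\<Sum>P\<in>Pow ?V \<times> Pow ?V - {({}, {})}. x ^ card (fst P) * x ^ card (snd P))"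
    using finV2 x0 by (intro sum_mono2) (auto simp: I_def)
  also have "\<dots> = (\<Sum>P\<in>Pow ?V \<times> Pow ?V. x ^ card (fst P) * x ^ card (snd P)) - 1"
    using finV2 by (subst sum_diff1) auto
  also have "(\<Sum>P\<in>Pow ?V \<times> Pow ?V. x ^ card (fst P) * x ^ card (snd P))
      = (\<Sum>S\<in>Pow ?V. x ^ card S) * (\<Sum>T\<in>Pow ?V. x ^ card T)"
    by (simp add: sum_product sum.cartesian_product split_def)
  also have "\<dots> = (1 + x) ^ (2 * n\<^sup>2)"
    by (simp add: sum_Pow_power_card finite_half_words card_half_words mult_2 power_add)
  also have "\<dots> \<le> exp x ^ (2 * n\<^sup>2)"
    using x0 by (intro power_mono) auto
  also have "\<dots> = exp (2 * real n ^ 2 * x)"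
    by (simp add: exp_of_nat_mult[symmetric])
  finally show ?thesis by simp
qed

section \<open>The limit as the number of generators tends to infinity\<close>

theorem theorem2p1:
  fixes d :: real
  assumes "1 / 2 < d" and "d < 1"
  shows "with_overwhelming_probability d
           (\<lambda>n R. square_group n R \<cong> integer_mod_group 4 \<and>
                  (\<forall>i\<in>gens n. \<forall>j\<in>gens n.
                     presented_gen (gens n) R i = presented_gen (gens n) R j))
         \<and> (\<lambda>n. measure_pmf.prob (random_relators n d)
                  {R. square_group n R \<cong> integer_mod_group 4}) \<longlonglongrightarrow> 1"
proof -
  let ?P = "\<lambda>n R. square_group n R \<cong> integer_mod_group 4 \<and>
                  (\<forall>i\<in>gens n. \<forall>j\<in>gens n.
                     presented_gen (gens n) R i = presented_gen (gens n) R j)"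
  let ?pr = "\<lambda>n. measure_pmf.prob (random_relators n d)"
  define b where "b n = 2 - exp (2 * real n ^ 2 *
      exp (- real (nat \<lfloor>real n powr (4 * d)\<rfloor>) / (2 * real n ^ 2)))" for n :: nat
  \<comment> \<open>There are about \<open>n powr (2 + e)\<close> relators, so the exponent in
    \<open>x\<close> is about \<open>- (n powr e) / 2\<close>, and \<open>x\<close> decays faster
    than \<open>n^2\<close> grows.\<close>
  define e where "e = 4 * d - 2"
  have e: "e > 0" and de: "4 * d = 2 + e" using assms(1) by (simp_all add: e_def)
  \<comment> \<open>The floor in \<open>b\<close> is replaced by its lower bound
    \<open>n powr (2 + e) - 1\<close>; this only weakens the estimate and leaves an expression with
    an elementary limit.\<close>
  define a where "a n = 2 - exp (2 * real n ^ 2 *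
      exp (- (real n powr (2 + e) - 1) / (2 * real n ^ 2)))" for n :: nat
  have a: "a \<longlonglongrightarrow> 1"
    unfolding a_def using e by real_asymp
  have ab: "a n \<le> b n" for n
  proof -
    have "real n powr (2 + e) - 1 \<le> real (nat \<lfloor>real n powr (4 * d)\<rfloor>)"
      unfolding de by linarith
    then have "exp (- real (nat \<lfloor>real n powr (4 * d)\<rfloor>) / (2 * real n ^ 2))
        \<le> exp (- (real n powr (2 + e) - 1) / (2 * real n ^ 2))"
      by (simp only: exp_le_cancel_iff) (rule divide_right_mono, simp_all)
    then show ?thesis
      unfolding a_def b_def by (simp add: mult_left_mono)
  qed
  have good: "b n \<le> ?pr n {R. ?P n R}" if "n > 0" for n
    unfolding b_def using that assms(2) by (rule prob_square_group_trivial_ge)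
  have lim: "f \<longlonglongrightarrow> 1" if "\<And>n. n > 0 \<Longrightarrow> a n \<le> f n" "\<And>n. f n \<le> 1" for f :: "nat \<Rightarrow> real"
  proof (rule tendsto_sandwich)
    show "\<forall>\<^sub>F n in sequentially. a n \<le> f n"
      using eventually_gt_at_top[of 0] by eventually_elim (rule that(1))
    show "\<forall>\<^sub>F n in sequentially. f n \<le> 1"
      using that(2) by simp
  qed (rule a tendsto_const)+
  have mono: "?pr n {R. ?P n R} \<le> ?pr n {R. square_group n R \<cong> integer_mod_group 4}" for n
  proof (rule measure_pmf.finite_measure_mono)
    show "{R. ?P n R} \<subseteq> {R. square_group n R \<cong> integer_mod_group 4}" by blast
  qed simp
  have "(\<lambda>n. ?pr n {R. ?P n R}) \<longlonglongrightarrow> 1"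
  proof (rule lim)
    show "a n \<le> ?pr n {R. ?P n R}" if "n > 0" for n
      using ab good[OF that] by (rule order_trans)
  qed (rule measure_pmf.prob_le_1)
  moreover have "(\<lambda>n. ?pr n {R. square_group n R \<cong> integer_mod_group 4}) \<longlonglongrightarrow> 1"
  proof (rule lim)
    show "a n \<le> ?pr n {R. square_group n R \<cong> integer_mod_group 4}" if "n > 0" for n
      using ab good[OF that] mono by (rule order_trans[OF order_trans])
  qed (rule measure_pmf.prob_le_1)
  ultimately show ?thesis
    unfolding with_overwhelming_probability_def by (rule conjI)
qed

end
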